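(* Let $K\subseteq\mathbb{R}^n$ be a closed set and $h:\mathbb{R}^n\to\mathbb{R}\cup\{\pm\infty\}$ a proper function such that $K\subseteq\operatorname{dom}h$. Suppose that $\overline{x}\in\operatorname{argmin}_K h$ and that $K$ is star-shaped at $\overline{x}$. If $h$ is strongly star quasiconvex on $K$ with modulus $\gamma>0$, then $h$ is $2$-supercoercive.
   Context: $h$ is proper if $\operatorname{dom}h:=\{x: h(x)<+\infty\}\ne\emptyset$ and $h>-\infty$ everywhere. $\operatorname{argmin}_K h$ is the set of minimizers of $h$ over $K$. $K$ is star-shaped at $\overline{x}\in K$ if $[\overline{x},x]\subseteq K$ for every $x\in K$. $h$ is strongly star quasiconvex on $K$ with modulus $\gamma>0$ if, with $\overline{x}\in\operatorname{argmin}_K h$ (then unique), for every $y\in K$ and $\lambda\in[0,1]$, $$h(\lambda\overline{x}+(1-\lambda)y)\le h(y)-\lambda(1-\lambda)\frac{\gamma}{2}\|y-\overline{x}\|^2.$$ A proper function $h:\mathbb{R}^n\to\mathbb{R}\cup\{\pm\infty\}$ is $2$-supercoercive if $$\liminf_{\|x\|\to+\infty}\frac{h(x)}{\|x\|^2}>0.$$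
   Formalization: As printed the claim fails (K={0}, h=0), since nothing constrains h off K; the conclusion proved is that h plus the indicator of K (h on K, +∞ off K) is 2-supercoercive, which is the printed claim when K = dom h, e.g. K = R^n. *)

theory Defs
  imports "HOL-Analysis.Analysis"
begin

definition effective_domain :: "('a \<Rightarrow> ereal) \<Rightarrow> 'a set" where
  "effective_domain h = {x. h x < \<infinity>}"

definition proper_fun :: "('a \<Rightarrow> ereal) \<Rightarrow> bool" where
  "proper_fun h \<longleftrightarrow> effective_domain h \<noteq> {} \<and> (\<forall>x. h x > -\<infinity>)"

definition argmin_on :: "'a set \<Rightarrow> ('a \<Rightarrow> ereal) \<Rightarrow> 'a set" where
  "argmin_on K h = {x. is_arg_min h (\<lambda>y. y \<in> K) x}"

definition star_shaped_at :: "'a::real_vector set \<Rightarrow> 'a \<Rightarrow> bool" where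
  "star_shaped_at K xbar \<longleftrightarrow> xbar \<in> K \<and> (\<forall>x\<in>K. closed_segment xbar x \<subseteq> K)"

text \<open>
  The minimizer in the inequality is quantified existentially; when K is star-shaped at a
  minimizer and h is finite on K, the inequality forces the minimizer to be unique, so this
  agrees with requiring the inequality at a prescribed minimizer.
\<close>
definition strongly_star_quasiconvex_on ::
    "'a::real_normed_vector set \<Rightarrow> real \<Rightarrow> ('a \<Rightarrow> ereal) \<Rightarrow> bool" where
  "strongly_star_quasiconvex_on K \<gamma> h \<longleftrightarrow> \<gamma> > 0 \<and>
     (\<exists>xbar\<in>argmin_on K h. \<forall>y\<in>K. \<forall>t\<in>{0..1}.
        h (t *\<^sub>R xbar + (1 - t) *\<^sub>R y)
          \<le> h y - ereal (t * (1 - t) * (\<gamma> / 2) * (norm (y - xbar))\<^sup>2))"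

definition two_supercoercive :: "('a::real_normed_vector \<Rightarrow> ereal) \<Rightarrow> bool" where
  "two_supercoercive h \<longleftrightarrow> proper_fun h \<and>
     Liminf at_infinity (\<lambda>x. h x / ereal ((norm x)\<^sup>2)) > 0"

definition convex_indicator :: "'a set \<Rightarrow> 'a \<Rightarrow> ereal" where
  "convex_indicator K x = (if x \<in> K then 0 else \<infinity>)"

lemma add_convex_indicator_eq:
  assumes "effective_domain h \<subseteq> K"
  shows "(\<lambda>x. h x + convex_indicator K x) = h"
proof
  fix x
  show "h x + convex_indicator K x = h x"
  proof (cases "x \<in> K")
    case False
    with assms have "h x = \<infinity>" by (auto simp: effective_domain_def)
    with False show ?thesis by (simp add: convex_indicator_def)
  qed (simp add: convex_indicator_def)
qed

text \<open>
  Strong star quasiconvexity on K says nothing about h outside K, so it cannot force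
  supercoercivity of h on the whole space: the zero function with K = {0} is a counterexample.
  Supercoercivity of a function considered on K is therefore expressed by
  two_supercoercive applied to h plus the indicator of K, that is, by the limit inferior
  along points of K (see the last lemma). This is h itself if dom h = K.
\<close>
lemma not_two_supercoercive_off_K:
  fixes h :: "real ^ 'n \<Rightarrow> ereal"
  defines "h \<equiv> \<lambda>_. 0"
  shows "closed {0 :: real ^ 'n}" and "proper_fun h" and "{0} \<subseteq> effective_domain h"
    and "0 \<in> argmin_on {0} h" and "star_shaped_at {0 :: real ^ 'n} 0"
    and "strongly_star_quasiconvex_on {0} 1 h" and "\<not> two_supercoercive h"
proof -
  have "(at_infinity :: (real ^ 'n) filter) \<noteq> bot"
    by (rule trivial_limit_at_infinity)
  then show "\<not> two_supercoercive h"
    by (simp add: two_supercoercive_def h_def Liminf_const)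
  show "closed {0 :: real ^ 'n}" by simp
  show "proper_fun h" and "{0} \<subseteq> effective_domain h"
    by (auto simp: proper_fun_def effective_domain_def h_def)
  show am: "0 \<in> argmin_on {0} h"
    by (simp add: argmin_on_def is_arg_min_def)
  show "star_shaped_at {0 :: real ^ 'n} 0"
    by (simp add: star_shaped_at_def)
  show "strongly_star_quasiconvex_on {0} 1 h"
    unfolding strongly_star_quasiconvex_on_def
    by (intro conjI bexI[OF _ am]) (simp_all add: h_def zero_ereal_def)
qed

lemma two_supercoercive_add_indicator_iff:
  fixes h :: "'a::real_normed_vector \<Rightarrow> ereal"
  assumes "\<And>x. h x > -\<infinity>"
  shows "two_supercoercive (\<lambda>x. h x + convex_indicator K x) \<longleftrightarrow>
    K \<inter> effective_domain h \<noteq> {} \<and>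
    Liminf (inf at_infinity (principal K)) (\<lambda>x. h x / ereal ((norm x)\<^sup>2)) > 0"
    (is "two_supercoercive ?g \<longleftrightarrow> _ \<and> Liminf ?F ?q > 0")
proof -
  have g_in: "?g x = h x" if "x \<in> K" for x using that by (simp add: convex_indicator_def)
  have g_out: "?g x = \<infinity>" if "x \<notin> K" for x using that by (simp add: convex_indicator_def)
  have "proper_fun ?g \<longleftrightarrow> K \<inter> effective_domain h \<noteq> {}"
    using assms by (auto simp: proper_fun_def effective_domain_def convex_indicator_def)
  moreover have "Liminf at_infinity (\<lambda>x. ?g x / ereal ((norm x)\<^sup>2)) = Liminf ?F ?q"
  proof -
    have div_out: "?g x / ereal ((norm x)\<^sup>2) = \<infinity>" if "x \<notin> K" for x
      using g_out[OF that] by (cases "x = 0") (auto simp: divide_ereal_def)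
    have pt: "y < ?g x / ereal ((norm x)\<^sup>2) \<longleftrightarrow> (x \<in> K \<longrightarrow> y < ?q x)" if "y < \<infinity>" for x y
      using that by (cases "x \<in> K") (simp_all only: div_out g_in simp_thms)
    have le_iff: "C \<le> Liminf at_infinity (\<lambda>x. ?g x / ereal ((norm x)\<^sup>2)) \<longleftrightarrow> C \<le> Liminf ?F ?q" for C
    proof -
      have "y < \<infinity>" if "y < C" for y
        using that by (rule order_less_le_trans) simp
      then show ?thesis
        unfolding le_Liminf_iff eventually_inf_principal by (simp only: pt cong: imp_cong)
    qed
    show ?thesis
      by (rule order_antisym[OF le_iff[THEN iffD1] le_iff[THEN iffD2]]) (rule order_refl)+
  qed
  ultimately show ?thesis by (simp add: two_supercoercive_def)
qed

end

theory Submission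
  imports Defs
begin

text \<open>
  At t = 1/2 the defining inequality compares h y with the value of h at the midpoint of xbar
  and y, which lies in K and hence is at least h xbar. So h grows quadratically on K:
  h y \<ge> h xbar + (\<gamma>/8) |y - xbar|^2, and |y - xbar| \<ge> |y|/2 for large y.
  The minimizer in the definition is xbar itself, by the same inequality at y = xbar.
\<close>

lemma argmin_on_iff:
  "x \<in> argmin_on K h \<longleftrightarrow> x \<in> K \<and> (\<forall>y\<in>K. h x \<le> (h y :: ereal))"
  by (auto simp: argmin_on_def is_arg_min_linorder)

lemma midpoint_mem_star_shaped:
  assumes "star_shaped_at K x" "y \<in> K"
  shows "midpoint x y \<in> K"
  using assms midpoint_in_closed_segment[of x y] unfolding star_shaped_at_def by blast

text \<open>The parameter 1/2 maximizes \<open>t * (1 - t)\<close>; the value 1/4 there turns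
  \<gamma>/2 into \<gamma>/8. The minimizer \<open>z\<close> is the one provided by the definition
  and is not yet known to be the prescribed one.\<close>

lemma strongly_star_quasiconvex_on_midpoint:
  assumes "strongly_star_quasiconvex_on K \<gamma> h"
  obtains z where "z \<in> argmin_on K h"
    "\<And>y. y \<in> K \<Longrightarrow> h (midpoint z y) \<le> h y - ereal (\<gamma> / 8 * (norm (y - z))\<^sup>2)"
proof -
  from assms obtain z where z: "z \<in> argmin_on K h"
    and ineq: "\<And>y t. y \<in> K \<Longrightarrow> t \<in> {0..1} \<Longrightarrow>
        h (t *\<^sub>R z + (1 - t) *\<^sub>R y) \<le> h y - ereal (t * (1 - t) * (\<gamma> / 2) * (norm (y - z))\<^sup>2)"
    unfolding strongly_star_quasiconvex_on_def by blast
  have "h (midpoint z y) \<le> h y - ereal (\<gamma> / 8 * (norm (y - z))\<^sup>2)" if "y \<in> K" for y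
    using ineq[OF that, of "1/2"] by (simp add: midpoint_def scaleR_add_right)
  with z show thesis by (rule that)
qed

lemma strongly_star_quasiconvex_on_quadratic_growth:
  fixes h :: "'a::real_normed_vector \<Rightarrow> ereal"
  assumes fin: "\<And>x. x \<in> K \<Longrightarrow> \<bar>h x\<bar> \<noteq> \<infinity>"
    and xbar: "xbar \<in> argmin_on K h"
    and star: "star_shaped_at K xbar"
    and "\<gamma> > 0"
    and ssqc: "strongly_star_quasiconvex_on K \<gamma> h"
    and "y \<in> K"
  shows "h xbar + ereal (\<gamma> / 8 * (norm (y - xbar))\<^sup>2) \<le> h y"
proof -
  obtain z where z: "z \<in> argmin_on K h"
    and mid: "\<And>y. y \<in> K \<Longrightarrow> h (midpoint z y) \<le> h y - ereal (\<gamma> / 8 * (norm (y - z))\<^sup>2)"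
    using strongly_star_quasiconvex_on_midpoint[OF ssqc] by blast
  have xK: "xbar \<in> K" and zK: "z \<in> K" and le: "\<And>y. y \<in> K \<Longrightarrow> h xbar \<le> h y"
    using xbar z by (auto simp: argmin_on_iff)
  \<comment> \<open>Identifies \<open>z\<close> with \<open>xbar\<close>: their midpoint stays in
    \<open>K\<close>, so its value is squeezed between \<open>h xbar\<close> and
    \<open>h xbar\<close> minus a multiple of the squared distance. Since \<open>h xbar\<close> is
    finite, it cancels and the distance must vanish.\<close>
  have "h xbar \<le> h (midpoint z xbar)"
    using le midpoint_mem_star_shaped[OF star zK] by (simp add: midpoint_sym)
  also have "\<dots> \<le> h xbar - ereal (\<gamma> / 8 * (norm (xbar - z))\<^sup>2)"
    using mid xK .
  finally have "\<gamma> / 8 * (norm (xbar - z))\<^sup>2 \<le> 0"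
    using fin[OF xK] by (cases "h xbar") auto
  with \<open>\<gamma> > 0\<close> have "z = xbar"
    by (simp add: mult_le_0_iff)
  have "h xbar \<le> h (midpoint xbar y)"
    using le midpoint_mem_star_shaped[OF star \<open>y \<in> K\<close>] .
  also have "\<dots> \<le> h y - ereal (\<gamma> / 8 * (norm (y - xbar))\<^sup>2)"
    using mid[OF \<open>y \<in> K\<close>] \<open>z = xbar\<close> by simp
  finally show ?thesis
    using fin[OF \<open>y \<in> K\<close>] by (simp add: ereal_le_minus)
qed

text \<open>Far out, the shift by \<open>a\<close> and the constant \<open>m\<close> are negligible
  against the quadratic term, so the quotient stays above a fixed positive number. For bounded
  \<open>K\<close> the filter is trivial and the limit inferior is \<infinity>.\<close>

lemma Liminf_pos_of_quadratic_growth: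
  fixes h :: "'a::real_normed_vector \<Rightarrow> ereal"
  assumes "c > 0"
    and growth: "\<And>y. y \<in> K \<Longrightarrow> ereal (m + c * (norm (y - a))\<^sup>2) \<le> h y"
  shows "Liminf (inf at_infinity (principal K)) (\<lambda>x. h x / ereal ((norm x)\<^sup>2)) > 0"
proof -
  \<comment> \<open>In the threshold, \<open>2 * norm a\<close> ensures that \<open>x - a\<close>
    has at least half the norm of \<open>x\<close>, which leaves c/4 of the quadratic coefficient.
    The term \<open>8 * \<bar>m\<bar> / c\<close> lets half of that absorb a negative
    \<open>m\<close>, leaving c/8.\<close>
  have bound: "ereal (c / 8) \<le> h x / ereal ((norm x)\<^sup>2)"
    if x: "norm x \<ge> 2 * norm a + 8 * \<bar>m\<bar> / c + 1" and "x \<in> K" for x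
  proof -
    have "8 * \<bar>m\<bar> / c \<ge> 0" using \<open>c > 0\<close> by simp
    then have n: "norm x \<ge> 1" "norm x / 2 \<le> norm x - norm a" "norm x \<ge> 8 * \<bar>m\<bar> / c"
      using x norm_ge_zero[of a] by linarith+
    have "(norm x / 2)\<^sup>2 \<le> (norm (x - a))\<^sup>2"
      using n(2) norm_triangle_ineq2[of x a] by (intro power_mono) auto
    then have "c * ((norm x)\<^sup>2 / 4) \<le> c * (norm (x - a))\<^sup>2"
      using \<open>c > 0\<close> by (simp add: power_divide)
    \<comment> \<open>The summand 1 in the threshold gives \<open>norm x \<ge> 1\<close>, so
      squaring does not decrease the norm and the linear bound becomes a quadratic one.\<close>
    moreover have "8 * \<bar>m\<bar> / c \<le> (norm x)\<^sup>2"
      using n(1,3) self_le_power[of "norm x" 2] by simp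
    then have "- m \<le> c / 8 * (norm x)\<^sup>2"
      using \<open>c > 0\<close> by (simp add: field_simps)
    ultimately have "c / 8 * (norm x)\<^sup>2 \<le> m + c * (norm (x - a))\<^sup>2"
      by simp
    then have "ereal (c / 8 * (norm x)\<^sup>2) \<le> h x"
      using growth[OF \<open>x \<in> K\<close>] order_trans by (metis ereal_less_eq(3))
    moreover have "(norm x)\<^sup>2 > 0" using n(1) by auto
    ultimately show ?thesis
      by (simp add: ereal_le_divide_pos mult.commute)
  qed
  have "0 < ereal (c / 8)" using \<open>c > 0\<close> by simp
  also have "\<dots> \<le> Liminf (inf at_infinity (principal K)) (\<lambda>x. h x / ereal ((norm x)\<^sup>2))"
    by (intro Liminf_bounded) (use bound in \<open>auto simp: eventually_inf_principal eventually_at_infinity\<close>)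
  finally show ?thesis .
qed

theorem proposition18:
  fixes K :: "(real ^ 'n) set" and h :: "real ^ 'n \<Rightarrow> ereal"
    and xbar :: "real ^ 'n" and \<gamma> :: real
  assumes "closed K"
    and "proper_fun h"
    and "K \<subseteq> effective_domain h"
    and "xbar \<in> argmin_on K h"
    and "star_shaped_at K xbar"
    and "\<gamma> > 0"
    and "strongly_star_quasiconvex_on K \<gamma> h"
  shows "two_supercoercive (\<lambda>x. h x + convex_indicator K x)"
proof -
  have gt: "h x > -\<infinity>" for x
    using \<open>proper_fun h\<close> by (simp add: proper_fun_def)
  have fin: "\<bar>h x\<bar> \<noteq> \<infinity>" if "x \<in> K" for x
    using gt[of x] that \<open>K \<subseteq> effective_domain h\<close> by (auto simp: effective_domain_def)
  have xK: "xbar \<in> K"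
    using \<open>star_shaped_at K xbar\<close> by (simp add: star_shaped_at_def)
  then obtain m where m: "h xbar = ereal m"
    using fin[of xbar] by (cases "h xbar") auto
  have "Liminf (inf at_infinity (principal K)) (\<lambda>x. h x / ereal ((norm x)\<^sup>2)) > 0"
  proof (rule Liminf_pos_of_quadratic_growth)
    show "\<gamma> / 8 > 0" using \<open>\<gamma> > 0\<close> by simp
    show "ereal (m + \<gamma> / 8 * (norm (y - xbar))\<^sup>2) \<le> h y" if "y \<in> K" for y
      using strongly_star_quasiconvex_on_quadratic_growth[OF fin assms(4-7) that] m by simp
  qed
  \<comment> \<open>Adding the indicator restricts the limit inferior to points of \<open>K\<close>;
    properness of the sum is witnessed by \<open>xbar\<close>, where \<open>h\<close> is
    finite.\<close>
  then show ?thesis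
    using xK \<open>K \<subseteq> effective_domain h\<close> by (auto simp: two_supercoercive_add_indicator_iff[OF gt])
qed

end
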